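(* Let $k\ge 1$ and $n=2k+1$, with all notation as in the context. Then: (a) for every skew edge of $M_k/\pi$ joining a vertex $u\in L_k/\pi$ to a vertex $w\in L_{k+1}/\pi$, there is also a skew edge of $M_k/\pi$ joining $\aleph_\pi^{-1}(w)\in L_k/\pi$ to $\aleph_\pi(u)\in L_{k+1}/\pi$; (i) for every skew edge $\{B,B'\}$ of $M_k$ with $B\in L_k$, $B'\in L_{k+1}$, the pair $\{\aleph^{-1}(B'),\aleph(B)\}$ is also a skew edge of $M_k$ (distinct from $\{B,B'\}$), so the skew edges of $M_k$ come in pairs $\{B,B'\},\{\aleph^{-1}(B'),\aleph(B)\}$ whose end-vertices form the two "horizontal" pairs $(B,\aleph(B))$ and $(\aleph^{-1}(B'),B')$; (ii) for every $u\in L_k/\pi$, the number of (horizontal) edges of $M_k/\pi$ joining $u$ and $\aleph_\pi(u)$ is at most $2$.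
   Context: Let $k\ge1$ and $n=2k+1$. Identify subsets $A\subseteq\{0,\dots,n-1\}$ with their characteristic binary strings $b_0b_1\dots b_{n-1}$ ($b_i=1$ iff $i\in A$). For $0\le j\le n$, $L_j$ is the set of subsets of size $j$. The middle-levels graph $M_k$ has vertex set $L_k\cup L_{k+1}$, with $A\in L_k$ adjacent to $A'\in L_{k+1}$ iff $A\subset A'$. Let $\pi$ be the equivalence relation on $L_k\cup L_{k+1}$ identifying two sets iff one is a cyclic translate of the other modulo $n$ (equivalently $\beta_{A'}(x)\equiv x^i\beta_A(x)\pmod{1+x^n}$ for some $i$, where $\beta_A(x)=\sum b_ix^i$); $L_j/\pi$ denotes the set of classes. The quotient multigraph $M_k/\pi$ has vertex set $L_k/\pi\cup L_{k+1}/\pi$ and its edges are the orbits of edges of $M_k$ under cyclic translation; thus the number of edges between $u\in L_k/\pi$ and $w\in L_{k+1}/\pi$ equals the number of $i\notin A$ with $A\cup\{i\}\in w$, for any fixed $A\in u$. Let $\aleph:L_k\to L_{k+1}$ be the bijection $\aleph(b_0b_1\dots b_{n-1})=\bar b_{n-1}\dots\bar b_1\bar b_0$ (complement and reverse, $\bar0=1,\bar1=0$); the same formula gives its inverse $L_{k+1}\to L_k$. It commutes with translation and induces a bijection $\aleph_\pi:L_k/\pi\to L_{k+1}/\pi$. An edge $\{B,B'\}$ of $M_k$ ($B\in L_k$) is horizontal if $B'=\aleph(B)$ and skew otherwise; an edge of $M_k/\pi$ between $u$ and $w$ is horizontal if $w=\aleph_\pi(u)$ and skew otherwise. *)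

theory Defs
  imports Main "HOL-Library.Disjoint_Sets"
begin

definition level :: "nat \<Rightarrow> nat \<Rightarrow> nat set set" where
  "level n j = {A. A \<subseteq> {..<n} \<and> card A = j}"

definition translate :: "nat \<Rightarrow> nat \<Rightarrow> nat set \<Rightarrow> nat set" where
  "translate n t A = (\<lambda>i. (i + t) mod n) ` A"

text \<open>On characteristic strings, the i-th bit of the image is the complement of the bit
  at position \<open>n - 1 - i\<close> of the argument.\<close>

definition aleph :: "nat \<Rightarrow> nat set \<Rightarrow> nat set" where
  "aleph n A = {i \<in> {..<n}. n - 1 - i \<notin> A}"

definition mid_vertices :: "nat \<Rightarrow> nat set set" where
  "mid_vertices k = level (2 * k + 1) k \<union> level (2 * k + 1) (k + 1)"

definition mid_edges :: "nat \<Rightarrow> nat set set set" where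
  "mid_edges k = {{A, A'} | A A'. A \<in> level (2 * k + 1) k \<and> A' \<in> level (2 * k + 1) (k + 1) \<and> A \<subset> A'}"

definition horizontal_pairs :: "nat \<Rightarrow> (nat set \<times> nat set) set" where
  "horizontal_pairs k = {(B, B'). B \<in> level (2 * k + 1) k \<and> B' \<in> level (2 * k + 1) (k + 1) \<and>
     B' = aleph (2 * k + 1) B}"

text \<open>A horizontal pair need not be adjacent in the middle-levels graph.\<close>

definition horizontal_edges :: "nat \<Rightarrow> nat set set set" where
  "horizontal_edges k = {e \<in> mid_edges k. \<exists>(B, B') \<in> horizontal_pairs k. e = {B, B'}}"

definition skew_edges :: "nat \<Rightarrow> nat set set set" where
  "skew_edges k = mid_edges k - horizontal_edges k"

definition cyc_rel :: "nat \<Rightarrow> (nat set \<times> nat set) set" where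
  "cyc_rel k = {(A, A'). A \<in> mid_vertices k \<and> A' \<in> mid_vertices k \<and>
     (\<exists>t. A' = translate (2 * k + 1) t A)}"

definition level_quot :: "nat \<Rightarrow> nat \<Rightarrow> nat set set set" where
  "level_quot k j = level (2 * k + 1) j // cyc_rel k"

definition edge_rel :: "nat \<Rightarrow> (nat set set \<times> nat set set) set" where
  "edge_rel k = {(e, e'). e \<in> mid_edges k \<and> e' \<in> mid_edges k \<and>
     (\<exists>t. e' = translate (2 * k + 1) t ` e)}"

definition quot_edges :: "nat \<Rightarrow> nat set set set set" where
  "quot_edges k = mid_edges k // edge_rel k"

text \<open>The quotient is a multigraph: distinct orbits may have the same set of end-vertices.\<close>

definition quot_ends :: "nat \<Rightarrow> nat set set set \<Rightarrow> nat set set set" where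
  "quot_ends k \<epsilon> = {cyc_rel k `` {A} | A e. e \<in> \<epsilon> \<and> A \<in> e}"

definition aleph_quot :: "nat \<Rightarrow> nat set set \<Rightarrow> nat set set" where
  "aleph_quot k u = aleph (2 * k + 1) ` u"

definition quot_horizontal_edges :: "nat \<Rightarrow> nat set set set set" where
  "quot_horizontal_edges k =
     {\<epsilon> \<in> quot_edges k. \<exists>u \<in> level_quot k k. quot_ends k \<epsilon> = {u, aleph_quot k u}}"

definition quot_skew_edges :: "nat \<Rightarrow> nat set set set set" where
  "quot_skew_edges k = quot_edges k - quot_horizontal_edges k"

text \<open>Inverses of the two bijections, each relative to its domain.\<close>

definition aleph_inv :: "nat \<Rightarrow> nat set \<Rightarrow> nat set" where
  "aleph_inv k = inv_into (level (2 * k + 1) k) (aleph (2 * k + 1))"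

definition aleph_quot_inv :: "nat \<Rightarrow> nat set set \<Rightarrow> nat set set" where
  "aleph_quot_inv k = inv_into (level_quot k k) (aleph_quot k)"

lemma aleph_aleph: "A \<subseteq> {..<n} \<Longrightarrow> aleph n (aleph n A) = A"
  by (auto simp: aleph_def)

lemma card_aleph:
  assumes "A \<subseteq> {..<n}"
  shows "card (aleph n A) = n - card A"
proof -
  have "aleph n A = (\<lambda>i. n - 1 - i) ` ({..<n} - A)"
  proof (intro equalityI subsetI)
    fix i assume "i \<in> aleph n A"
    then have "n - 1 - i \<in> {..<n} - A" "i = n - 1 - (n - 1 - i)"
      by (auto simp: aleph_def)
    then show "i \<in> (\<lambda>i. n - 1 - i) ` ({..<n} - A)" by blast
  qed (auto simp: aleph_def)
  moreover have "inj_on (\<lambda>i. n - 1 - i) ({..<n} - A)"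
    by (auto simp: inj_on_def)
  ultimately have "card (aleph n A) = card ({..<n} - A)"
    by (simp add: card_image)
  also have "\<dots> = n - card A"
    using assms by (simp add: card_Diff_subset finite_subset)
  finally show ?thesis .
qed

lemma aleph_bij: "bij_betw (aleph (2 * k + 1)) (level (2 * k + 1) k) (level (2 * k + 1) (k + 1))"
proof (rule bij_betw_byWitness[where f' = "aleph (2 * k + 1)"])
  have sub: "aleph n A \<subseteq> {..<n}" for n A by (auto simp: aleph_def)
  show "aleph (2 * k + 1) ` level (2 * k + 1) k \<subseteq> level (2 * k + 1) (k + 1)"
    using sub by (auto simp: level_def card_aleph simp del: One_nat_def)
  show "aleph (2 * k + 1) ` level (2 * k + 1) (k + 1) \<subseteq> level (2 * k + 1) k"
    using sub by (auto simp: level_def card_aleph simp del: One_nat_def)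
qed (simp_all add: level_def aleph_aleph)

end

theory Submission
  imports Defs
begin

text \<open>
  Everything rests on the involution \<open>aleph\<close>, which reverses inclusion and normalizes the group of
  translations. For the bound on horizontal edges: \<open>insert i A\<close> is a translate of \<open>aleph n A\<close> iff
  modulo \<open>n\<close> the reflection \<open>x \<mapsto> 2i - x\<close> maps \<open>A\<close> onto the complement of \<open>insert i A\<close>. If \<open>i\<close> and
  \<open>j\<close> are two such centres, then composing the two reflections shows that \<open>x\<close> and
  \<open>x + 2(j - i)\<close> are both in \<open>A\<close> or both outside \<open>A\<close>, unless \<open>x\<close> is \<open>i\<close> or \<open>2i - j\<close>. A third
  centre \<open>f\<close> contradicts this at \<open>x = f - (j - i)\<close>, because reflection in \<open>f\<close> exchanges
  \<open>f - (j - i)\<close> and \<open>f + (j - i)\<close>.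
\<close>

subsection \<open>Translation and complemented reversal\<close>

text \<open>Positions are read as integers modulo \<open>n\<close>, so that shifts and reflections
  become sums and differences free of truncated subtraction.\<close>

definition cmem :: "nat \<Rightarrow> nat set \<Rightarrow> int \<Rightarrow> bool" where
  "cmem n A x \<longleftrightarrow> nat (x mod int n) \<in> A"

lemma cmem_cong: "x mod int n = y mod int n \<Longrightarrow> cmem n A x = cmem n A y"
  by (simp add: cmem_def)

lemma cmem_int: "i < n \<Longrightarrow> cmem n A (int i) \<longleftrightarrow> i \<in> A"
  by (simp add: cmem_def)

lemma cmem_eqI:
  assumes "A \<subseteq> {..<n}" "B \<subseteq> {..<n}" "\<And>x. cmem n A x = cmem n B x"
  shows "A = B"
proof -
  have "i \<in> A \<longleftrightarrow> i \<in> B" if "i < n" for i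
    using assms(3)[of "int i"] that by (simp add: cmem_int)
  then show ?thesis using assms(1,2) by blast
qed

lemma translate_subset: "0 < n \<Longrightarrow> translate n t A \<subseteq> {..<n}"
  by (auto simp: translate_def)

lemma aleph_subset: "aleph n A \<subseteq> {..<n}"
  by (auto simp: aleph_def)

lemma cmem_translate:
  assumes "0 < n" "A \<subseteq> {..<n}"
  shows "cmem n (translate n t A) x \<longleftrightarrow> cmem n A (x - int t)"
proof
  assume "cmem n (translate n t A) x"
  then obtain a where a: "a \<in> A" "nat (x mod int n) = (a + t) mod n"
    by (auto simp: cmem_def translate_def)
  have "int (nat (x mod int n)) = x mod int n" using assms by simp
  then have "x mod int n = (int a + int t) mod int n"
    using a(2) by (simp add: zmod_int)
  then have "(x - int t) mod int n = int a mod int n"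
    by (metis add_diff_cancel_right' mod_diff_left_eq)
  then show "cmem n A (x - int t)" using a(1) assms by (auto simp: cmem_def)
next
  assume *: "cmem n A (x - int t)"
  define a where "a = nat ((x - int t) mod int n)"
  have a: "a \<in> A" using * by (simp add: a_def cmem_def)
  have "int a = (x - int t) mod int n" using assms by (simp add: a_def)
  then have "int ((a + t) mod n) = x mod int n"
    by (simp add: zmod_int mod_add_left_eq)
  then have "(a + t) mod n = nat (x mod int n)" by linarith
  then show "cmem n (translate n t A) x"
    using a unfolding cmem_def translate_def by (metis imageI)
qed

text \<open>Modulo \<open>n\<close> the reversal of positions is the reflection
  \<open>- 1 - x\<close>; complementation supplies the negation.\<close>

lemma cmem_aleph:
  assumes "0 < n"
  shows "cmem n (aleph n A) x \<longleftrightarrow> \<not> cmem n A (- 1 - x)"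
proof -
  define r where "r = nat (x mod int n)"
  have r: "int r = x mod int n" "r < n"
    using assms by (simp_all add: r_def nat_less_iff)
  have "int (n - 1 - r) = int n + (- 1 - int r)" using r(2) by simp
  also have "\<dots> mod int n = (- 1 - int r) mod int n" by simp
  also have "\<dots> = (- 1 - x) mod int n" by (simp add: r(1) mod_diff_right_eq)
  finally have "(- 1 - x) mod int n = int (n - 1 - r)"
    using assms by (simp flip: of_nat_mod)
  then have "nat ((- 1 - x) mod int n) = n - 1 - r" by simp
  then show ?thesis using r(2) by (auto simp: cmem_def aleph_def r_def)
qed

lemma translate_0: "A \<subseteq> {..<n} \<Longrightarrow> translate n 0 A = A"
  by (force simp: translate_def)

lemma translate_translate:
  assumes "0 < n" "A \<subseteq> {..<n}"
  shows "translate n t (translate n s A) = translate n (s + t) A"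
  by (rule cmem_eqI[where n = n])
    (simp_all add: assms translate_subset cmem_translate algebra_simps)

text \<open>Shifts are natural numbers, so the opposite of \<open>t\<close> is represented by
  \<open>t * (n - 1)\<close>: the two add up to \<open>t * n\<close>.\<close>

lemma translate_inverse:
  assumes "0 < n" "A \<subseteq> {..<n}"
  shows "translate n (t * (n - 1)) (translate n t A) = A"
proof -
  have "t + t * (n - 1) = t * n" using assms by (cases n) auto
  then have "translate n (t * (n - 1)) (translate n t A) = translate n (t * n) A"
    using assms by (simp add: translate_translate)
  also have "\<dots> = A"
    by (rule cmem_eqI[where n = n])
      (auto simp: assms translate_subset cmem_translate mod_eq_dvd_iff intro!: cmem_cong)
  finally show ?thesis .
qed

text \<open>Each of the two sets is an image of the other, the second by the opposite shift, so the
  cardinalities bound each other.\<close>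

lemma card_translate:
  assumes "0 < n" "A \<subseteq> {..<n}"
  shows "card (translate n t A) = card A"
proof (rule antisym)
  have fin: "finite (translate n t A)" "finite A"
    using assms finite_subset[OF translate_subset] finite_subset[OF assms(2)] by auto
  show "card (translate n t A) \<le> card A"
    using fin by (simp add: translate_def card_image_le)
  show "card A \<le> card (translate n t A)"
    using translate_inverse[OF assms, of t] fin
    by (metis card_image_le translate_def)
qed

text \<open>A reflection reverses the direction of a shift, so \<open>t\<close> becomes its
  opposite, again written \<open>t * (n - 1)\<close>.\<close>

lemma aleph_translate:
  assumes "0 < n" "A \<subseteq> {..<n}"
  shows "aleph n (translate n t A) = translate n (t * (n - 1)) (aleph n A)"
proof (rule cmem_eqI[where n = n])
  fix x
  have "int t + int (t * (n - 1)) = int t * int n"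
    using assms by (simp add: of_nat_diff algebra_simps)
  then have "- 1 - x - int t = - 1 - (x - int (t * (n - 1))) - int t * int n" by simp
  then have "(- 1 - x - int t) mod int n = (- 1 - (x - int (t * (n - 1)))) mod int n"
    by (simp add: mod_eq_dvd_iff)
  then have "cmem n A (- 1 - x - int t) = cmem n A (- 1 - (x - int (t * (n - 1))))"
    by (rule cmem_cong)
  then show "cmem n (aleph n (translate n t A)) x =
      cmem n (translate n (t * (n - 1)) (aleph n A)) x"
    using assms by (simp add: cmem_aleph cmem_translate aleph_subset)
qed (simp_all add: assms aleph_subset translate_subset)

section \<open>Effect of both operations on levels and inclusions\<close>

lemma translate_level: "0 < n \<Longrightarrow> A \<in> level n j \<Longrightarrow> translate n t A \<in> level n j"
  by (simp add: level_def translate_subset card_translate)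

lemma translate_strict_mono:
  assumes "0 < n" "A \<subset> B" "B \<subseteq> {..<n}"
  shows "translate n t A \<subset> translate n t B"
proof -
  have "A \<subseteq> {..<n}" using assms by blast
  then have "translate n t A \<noteq> translate n t B"
    using assms translate_inverse[of n _ t] by (metis psubsetE)
  moreover have "translate n t A \<subseteq> translate n t B"
    using assms by (auto simp: translate_def)
  ultimately show ?thesis by blast
qed

lemma aleph_strict_antimono:
  assumes "A \<subset> B" "B \<subseteq> {..<n}"
  shows "aleph n B \<subset> aleph n A"
proof -
  have "aleph n B \<noteq> aleph n A"
    using assms aleph_aleph[of A n] aleph_aleph[of B n] by auto
  moreover have "aleph n B \<subseteq> aleph n A" using assms by (auto simp: aleph_def)
  ultimately show ?thesis by blast
qed

lemma aleph_level_lower: "A \<in> level (2 * k + 1) k \<Longrightarrow> aleph (2 * k + 1) A \<in> level (2 * k + 1) (k + 1)"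
  using aleph_bij[of k] by (auto simp: bij_betw_def)

lemma aleph_level_upper:
  "A \<in> level (2 * k + 1) (k + 1) \<Longrightarrow> aleph (2 * k + 1) A \<in> level (2 * k + 1) k"
  using aleph_subset[of "2 * k + 1" A] by (simp add: level_def card_aleph)

text \<open>Replaces the inverse given by \<open>inv_into\<close> with the explicit
  involution.\<close>

lemma aleph_inv_eq:
  assumes "B \<in> level (2 * k + 1) (k + 1)"
  shows "aleph_inv k B = aleph (2 * k + 1) B"
  unfolding aleph_inv_def
  using assms aleph_level_upper aleph_bij[of k] aleph_aleph[of B]
  by (intro inv_into_f_eq) (auto simp: bij_betw_def level_def)

subsection \<open>Edges of the middle-levels graph\<close>

lemma level_disjoint: "A \<in> level n k \<Longrightarrow> B \<in> level n (k + 1) \<Longrightarrow> A \<noteq> B"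
  by (auto simp: level_def)

text \<open>Edges are unordered, but the different cardinalities of the two levels tell the lower
  end from the upper one.\<close>

lemma level_doubleton_eq_iff:
  assumes "A \<in> level n k" "B \<in> level n k" "A' \<in> level n (k + 1)" "B' \<in> level n (k + 1)"
  shows "{A, A'} = {B, B'} \<longleftrightarrow> A = B \<and> A' = B'"
  using level_disjoint[OF assms(1,4)] level_disjoint[OF assms(2,3)]
  unfolding doubleton_eq_iff by blast

lemma mid_edgeE:
  assumes "e \<in> mid_edges k"
  obtains A A' where "e = {A, A'}" "A \<in> level (2 * k + 1) k" "A' \<in> level (2 * k + 1) (k + 1)"
    "A \<subset> A'"
  using assms by (auto simp: mid_edges_def)

lemma doubleton_mid_edge_iff:
  assumes "A \<in> level (2 * k + 1) k" "A' \<in> level (2 * k + 1) (k + 1)"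
  shows "{A, A'} \<in> mid_edges k \<longleftrightarrow> A \<subset> A'"
proof
  assume "{A, A'} \<in> mid_edges k"
  then obtain B B' where B: "{A, A'} = {B, B'}" "B \<in> level (2 * k + 1) k"
    "B' \<in> level (2 * k + 1) (k + 1)" "B \<subset> B'"
    by (rule mid_edgeE)
  with level_doubleton_eq_iff[OF assms(1) B(2) assms(2) B(3)] show "A \<subset> A'" by blast
next
  assume "A \<subset> A'"
  with assms show "{A, A'} \<in> mid_edges k" unfolding mid_edges_def by blast
qed

text \<open>Once the levels of the ends are known, only one pair can witness horizontality, and the
  existential over \<open>horizontal_pairs\<close> disappears.\<close>

lemma doubleton_skew_edge_iff:
  assumes "A \<in> level (2 * k + 1) k" "A' \<in> level (2 * k + 1) (k + 1)"
  shows "{A, A'} \<in> skew_edges k \<longleftrightarrow> A \<subset> A' \<and> A' \<noteq> aleph (2 * k + 1) A"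
proof -
  have "(\<exists>(B, B') \<in> horizontal_pairs k. {A, A'} = {B, B'}) \<longleftrightarrow> A' = aleph (2 * k + 1) A"
  proof
    assume "\<exists>(B, B') \<in> horizontal_pairs k. {A, A'} = {B, B'}"
    then obtain B B' where B: "B \<in> level (2 * k + 1) k" "B' \<in> level (2 * k + 1) (k + 1)"
      "B' = aleph (2 * k + 1) B" "{A, A'} = {B, B'}"
      unfolding horizontal_pairs_def by blast
    then have "A = B" "A' = B'"
      using level_doubleton_eq_iff[OF assms(1) B(1) assms(2) B(2)] by blast+
    with B(3) show "A' = aleph (2 * k + 1) A" by simp
  next
    assume "A' = aleph (2 * k + 1) A"
    with assms have "(A, A') \<in> horizontal_pairs k" by (simp add: horizontal_pairs_def)
    then show "\<exists>(B, B') \<in> horizontal_pairs k. {A, A'} = {B, B'}" by blast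
  qed
  then show ?thesis
    unfolding skew_edges_def horizontal_edges_def
    using doubleton_mid_edge_iff[OF assms] by auto
qed

lemma skew_edgeE:
  assumes "e \<in> skew_edges k"
  obtains A A' where "e = {A, A'}" "A \<in> level (2 * k + 1) k" "A' \<in> level (2 * k + 1) (k + 1)"
    "A \<subset> A'" "A' \<noteq> aleph (2 * k + 1) A"
proof -
  have "e \<in> mid_edges k" using assms by (simp add: skew_edges_def)
  then show ?thesis
    using assms doubleton_skew_edge_iff that by (metis mid_edgeE)
qed

lemma mid_edge_vertices: "e \<in> mid_edges k \<Longrightarrow> e \<subseteq> mid_vertices k"
  by (auto simp: mid_edges_def mid_vertices_def)

lemma mid_vertex_subset: "A \<in> mid_vertices k \<Longrightarrow> A \<subseteq> {..<2 * k + 1}"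
  by (auto simp: mid_vertices_def level_def)

lemma translate_mid_edge:
  assumes "e \<in> mid_edges k"
  shows "translate (2 * k + 1) t ` e \<in> mid_edges k"
proof -
  obtain A A' where A: "e = {A, A'}" "A \<in> level (2 * k + 1) k"
    "A' \<in> level (2 * k + 1) (k + 1)" "A \<subset> A'"
    using assms by (rule mid_edgeE)
  have "translate (2 * k + 1) t A \<subset> translate (2 * k + 1) t A'"
    using A by (intro translate_strict_mono) (auto simp: level_def)
  then show ?thesis
    using A translate_level[of "2 * k + 1"] doubleton_mid_edge_iff by simp
qed

text \<open>Adjacency survives because \<open>aleph\<close> reverses inclusion while exchanging the
  levels. Were the image horizontal, its upper end \<open>aleph (2 * k + 1) B\<close> would equal
  \<open>aleph\<close> of its lower end, which is \<open>B'\<close>, against skewness. The same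
  inequality separates the two edges.\<close>

lemma aleph_skew_edge:
  assumes "B \<in> level (2 * k + 1) k" "B' \<in> level (2 * k + 1) (k + 1)" "{B, B'} \<in> skew_edges k"
  shows "{aleph (2 * k + 1) B', aleph (2 * k + 1) B} \<in> skew_edges k"
    and "{aleph (2 * k + 1) B', aleph (2 * k + 1) B} \<noteq> {B, B'}"
proof -
  let ?f = "aleph (2 * k + 1)"
  have s: "B \<subset> B'" "B' \<noteq> ?f B" using assms doubleton_skew_edge_iff by blast+
  have sub: "B' \<subseteq> {..<2 * k + 1}" using assms by (simp add: level_def)
  have l: "?f B' \<in> level (2 * k + 1) k" "?f B \<in> level (2 * k + 1) (k + 1)"
    using assms aleph_level_lower aleph_level_upper by blast+
  show "{?f B', ?f B} \<in> skew_edges k"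
    using s l sub aleph_strict_antimono[OF s(1) sub] aleph_aleph[OF sub]
    by (simp add: doubleton_skew_edge_iff)
  show "{?f B', ?f B} \<noteq> {B, B'}"
    using level_doubleton_eq_iff[OF l(1) assms(1) l(2) assms(2)] s(2) by blast
qed

text \<open>The same four vertices are read in two ways: as two skew edges, and as two
  \<open>aleph\<close>-pairs, which need not be adjacent.\<close>

lemma skew_edge_pair:
  assumes "B \<in> level (2 * k + 1) k" "B' \<in> level (2 * k + 1) (k + 1)" "{B, B'} \<in> skew_edges k"
  shows "{aleph_inv k B', aleph (2 * k + 1) B} \<in> skew_edges k \<and>
      {aleph_inv k B', aleph (2 * k + 1) B} \<noteq> {B, B'} \<and>
      (B, aleph (2 * k + 1) B) \<in> horizontal_pairs k \<and>
      (aleph_inv k B', B') \<in> horizontal_pairs k \<and>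
      (B, aleph (2 * k + 1) B) \<noteq> (aleph_inv k B', B') \<and>
      {B, B'} \<union> {aleph_inv k B', aleph (2 * k + 1) B} =
        {B, aleph (2 * k + 1) B} \<union> {aleph_inv k B', B'}"
proof -
  let ?f = "aleph (2 * k + 1)"
  have ne: "?f B \<noteq> B'" using assms doubleton_skew_edge_iff by blast
  have "?f (?f B') = B'" using assms(2) by (intro aleph_aleph) (simp add: level_def)
  then have "(?f B', B') \<in> horizontal_pairs k"
    using assms(2) aleph_level_upper by (simp add: horizontal_pairs_def)
  moreover have "(B, ?f B) \<in> horizontal_pairs k"
    using assms(1) aleph_level_lower by (simp add: horizontal_pairs_def)
  ultimately show ?thesis
    unfolding aleph_inv_eq[OF assms(2)] using aleph_skew_edge[OF assms] ne
    by (intro conjI) auto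
qed

text \<open>The blocks are the orbits of the involution, and two orbits with a common point
  coincide.\<close>

lemma partition_on_involution:
  assumes "\<And>x. x \<in> S \<Longrightarrow> f x \<in> S" "\<And>x. x \<in> S \<Longrightarrow> f (f x) = x"
  shows "partition_on S ((\<lambda>x. {x, f x}) ` S)"
proof (rule partition_onI)
  show "\<Union> ((\<lambda>x. {x, f x}) ` S) = S" using assms(1) by auto
next
  fix p q assume "p \<in> (\<lambda>x. {x, f x}) ` S" "q \<in> (\<lambda>x. {x, f x}) ` S" "p \<noteq> q"
  then show "disjnt p q" using assms(2) by (auto simp: disjnt_def) (metis insert_commute)+
qed auto

text \<open>On unordered edges the partner is the image under \<open>aleph\<close>, and this is an
  involution of the skew edges. Its orbits are the blocks.\<close>

lemma partition_skew_edges: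
  "partition_on (skew_edges k)
    {{{B, B'}, {aleph_inv k B', aleph (2 * k + 1) B}} | B B'.
      B \<in> level (2 * k + 1) k \<and> B' \<in> level (2 * k + 1) (k + 1) \<and> {B, B'} \<in> skew_edges k}"
    (is "partition_on _ ?P")
proof -
  let ?f = "aleph (2 * k + 1)"
  have "(\<lambda>e. {e, ?f ` e}) ` skew_edges k = ?P"
  proof (intro equalityI subsetI)
    fix p assume "p \<in> (\<lambda>e. {e, ?f ` e}) ` skew_edges k"
    then obtain e where e: "e \<in> skew_edges k" "p = {e, ?f ` e}" by blast
    obtain A A' where A: "e = {A, A'}" "A \<in> level (2 * k + 1) k"
      "A' \<in> level (2 * k + 1) (k + 1)"
      using e(1) by (rule skew_edgeE)
    have "p = {{A, A'}, {aleph_inv k A', ?f A}}"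
      using e(2) A by (auto simp: aleph_inv_eq)
    then show "p \<in> ?P" using A e(1) by blast
  next
    fix p assume "p \<in> ?P"
    then obtain B B' where B: "p = {{B, B'}, {aleph_inv k B', ?f B}}"
      "B' \<in> level (2 * k + 1) (k + 1)" "{B, B'} \<in> skew_edges k" by blast
    have "p = {{B, B'}, ?f ` {B, B'}}" using B by (auto simp: aleph_inv_eq)
    then show "p \<in> (\<lambda>e. {e, ?f ` e}) ` skew_edges k" using B(3) by blast
  qed
  moreover have "partition_on (skew_edges k) ((\<lambda>e. {e, ?f ` e}) ` skew_edges k)"
  proof (rule partition_on_involution)
    fix e assume e: "e \<in> skew_edges k"
    then obtain A A' where A: "e = {A, A'}" "A \<in> level (2 * k + 1) k"
      "A' \<in> level (2 * k + 1) (k + 1)"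
      by (rule skew_edgeE)
    show "?f ` e \<in> skew_edges k"
      using aleph_skew_edge(1)[of A k A'] A e by (simp add: insert_commute)
    show "?f ` ?f ` e = e"
      using A aleph_aleph by (simp add: level_def)
  qed
  ultimately show ?thesis by simp
qed

subsection \<open>The quotient multigraph\<close>

text \<open>Translations preserve both levels, so the class is the whole orbit.\<close>

lemma cyc_class:
  assumes "A \<in> mid_vertices k"
  shows "cyc_rel k `` {A} = range (\<lambda>t. translate (2 * k + 1) t A)"
  using assms translate_level[of "2 * k + 1" A]
  by (auto simp: cyc_rel_def mid_vertices_def)

lemma edge_class:
  assumes "e \<in> mid_edges k"
  shows "edge_rel k `` {e} = range (\<lambda>t. translate (2 * k + 1) t ` e)"
  using assms translate_mid_edge by (auto simp: edge_rel_def)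

text \<open>Stands in for symmetry and transitivity of \<open>cyc_rel\<close>: any member of an
  orbit generates that orbit.\<close>

lemma cyc_class_translate:
  assumes "A \<in> mid_vertices k"
  shows "cyc_rel k `` {translate (2 * k + 1) t A} = cyc_rel k `` {A}"
proof -
  let ?n = "2 * k + 1"
  have A: "A \<subseteq> {..<?n}" using assms by (rule mid_vertex_subset)
  have tA: "translate ?n t A \<in> mid_vertices k"
    using assms translate_level[of ?n A] by (auto simp: mid_vertices_def)
  \<comment> \<open>First undo the shift by \<open>t\<close>, then shift by
    \<open>s\<close>.\<close>
  have "translate ?n s A = translate ?n (t * (?n - 1) + s) (translate ?n t A)" for s
    using translate_inverse[of ?n A t] translate_translate[of ?n "translate ?n t A" s "t * (?n - 1)"]
      A translate_subset[of ?n] by simp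
  then have "translate ?n s A \<in> range (\<lambda>r. translate ?n r (translate ?n t A))" for s
    by (rule range_eqI)
  moreover have "translate ?n s (translate ?n t A) = translate ?n (t + s) A" for s
    using translate_translate[of ?n A s t] A by simp
  then have "translate ?n s (translate ?n t A) \<in> range (\<lambda>r. translate ?n r A)" for s
    by (rule range_eqI)
  ultimately show ?thesis
    unfolding cyc_class[OF assms] cyc_class[OF tA] by (intro equalityI image_subsetI)
qed

text \<open>One and the same shift undoes \<open>t\<close> at both ends of an edge, so the argument
  for vertices lifts to images of edges.\<close>

lemma edge_class_translate:
  assumes "e \<in> mid_edges k"
  shows "edge_rel k `` {translate (2 * k + 1) t ` e} = edge_rel k `` {e}"
proof -
  let ?n = "2 * k + 1"
  have e: "A \<subseteq> {..<?n}" if "A \<in> e" for A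
    using that mid_edge_vertices[OF assms] mid_vertex_subset by blast
  have "translate ?n s A = translate ?n (t * (?n - 1) + s) (translate ?n t A)" if "A \<in> e" for s A
    using translate_inverse[of ?n A t] translate_translate[of ?n "translate ?n t A" s "t * (?n - 1)"]
      e[OF that] translate_subset[of ?n] by simp
  then have "translate ?n s ` e = translate ?n (t * (?n - 1) + s) ` translate ?n t ` e" for s
    unfolding image_image by (rule image_cong[OF refl])
  then have "translate ?n s ` e \<in> range (\<lambda>r. translate ?n r ` translate ?n t ` e)" for s
    by (rule range_eqI)
  moreover have "translate ?n s ` translate ?n t ` e = translate ?n (t + s) ` e" for s
    unfolding image_image
    by (rule image_cong[OF refl]) (use e translate_translate[of ?n] in simp)
  then have "translate ?n s ` translate ?n t ` e \<in> range (\<lambda>r. translate ?n r ` e)" for s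
    by (rule range_eqI)
  ultimately show ?thesis
    unfolding edge_class[OF assms] edge_class[OF translate_mid_edge[OF assms]]
    by (intro equalityI image_subsetI)
qed

lemma cyc_class_self:
  assumes "A \<in> mid_vertices k"
  shows "A \<in> cyc_rel k `` {A}"
  using translate_0[OF mid_vertex_subset[OF assms]] unfolding cyc_class[OF assms]
  by (metis rangeI)

lemma edge_class_self:
  assumes "e \<in> mid_edges k"
  shows "e \<in> edge_rel k `` {e}"
proof -
  have "translate (2 * k + 1) 0 ` e = e"
    using mid_edge_vertices[OF assms] translate_0[OF mid_vertex_subset] by (force simp: image_iff)
  then show ?thesis unfolding edge_class[OF assms] by (metis rangeI)
qed

text \<open>Translating an edge does not change the classes of its ends, so a single representative
  determines the ends of the orbit.\<close>

lemma quot_ends_class: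
  assumes "{A, A'} \<in> mid_edges k"
  shows "quot_ends k (edge_rel k `` {{A, A'}}) = {cyc_rel k `` {A}, cyc_rel k `` {A'}}"
proof -
  have v: "A \<in> mid_vertices k" "A' \<in> mid_vertices k" using mid_edge_vertices[OF assms] by auto
  let ?E = "edge_rel k `` {{A, A'}}"
  have "cyc_rel k `` {B} \<in> quot_ends k ?E" if "B \<in> {A, A'}" for B
    unfolding quot_ends_def
    by (intro CollectI exI[of _ B] exI[of _ "{A, A'}"] conjI refl edge_class_self assms that)
  moreover have "x \<in> {cyc_rel k `` {A}, cyc_rel k `` {A'}}" if x: "x \<in> quot_ends k ?E" for x
  proof -
    obtain C e where C: "x = cyc_rel k `` {C}" "e \<in> ?E" "C \<in> e"
      using x unfolding quot_ends_def by blast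
    then obtain t where "C = translate (2 * k + 1) t A \<or> C = translate (2 * k + 1) t A'"
      unfolding edge_class[OF assms] by blast
    then show ?thesis using C(1) cyc_class_translate v by (metis insertCI)
  qed
  ultimately show ?thesis by blast
qed

section \<open>The two levels of the quotient\<close>

lemma level_quotE:
  assumes "u \<in> level_quot k j"
  obtains A where "A \<in> level (2 * k + 1) j" "u = cyc_rel k `` {A}"
  using assms by (auto simp: level_quot_def elim: quotientE)

lemma level_quotI: "A \<in> level (2 * k + 1) j \<Longrightarrow> cyc_rel k `` {A} \<in> level_quot k j"
  by (simp add: level_quot_def quotientI)

text \<open>\<open>cyc_rel\<close> is defined on both levels at once; that no class meets both comes
  from invariance of cardinality under translation.\<close>

lemma level_quot_disjoint:
  assumes "u \<in> level_quot k k" "w \<in> level_quot k (k + 1)"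
  shows "u \<noteq> w"
proof
  assume "u = w"
  obtain A where A: "A \<in> level (2 * k + 1) k" "u = cyc_rel k `` {A}" using assms(1) by (rule level_quotE)
  obtain B where B: "B \<in> level (2 * k + 1) (k + 1)" "w = cyc_rel k `` {B}"
    using assms(2) by (rule level_quotE)
  have "A \<in> cyc_rel k `` {B}"
    using cyc_class_self[of A k] A B \<open>u = w\<close> by (auto simp: mid_vertices_def)
  then have "A \<in> level (2 * k + 1) (k + 1)"
    using cyc_class[of B k] B(1) translate_level[of "2 * k + 1" B "k + 1"]
    by (auto simp: mid_vertices_def simp del: Image_singleton_iff)
  with A(1) show False using level_disjoint by blast
qed

lemma level_quot_doubleton_eq_iff:
  assumes "u \<in> level_quot k k" "v \<in> level_quot k k"
    "u' \<in> level_quot k (k + 1)" "v' \<in> level_quot k (k + 1)"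
  shows "{u, u'} = {v, v'} \<longleftrightarrow> u = v \<and> u' = v'"
  using level_quot_disjoint[OF assms(1,4)] level_quot_disjoint[OF assms(2,3)]
  unfolding doubleton_eq_iff by blast

lemma quot_edgeE:
  assumes "\<epsilon> \<in> quot_edges k"
  obtains A A' where "\<epsilon> = edge_rel k `` {{A, A'}}" "{A, A'} \<in> mid_edges k"
    "A \<in> level (2 * k + 1) k" "A' \<in> level (2 * k + 1) (k + 1)" "A \<subset> A'"
  using assms mid_edgeE unfolding quot_edges_def by (metis quotientE)

text \<open>Since \<open>aleph\<close> turns each shift into the opposite one, the elementwise image
  of an orbit is again a full orbit.\<close>

lemma aleph_quot_class:
  assumes "A \<in> mid_vertices k"
  shows "aleph_quot k (cyc_rel k `` {A}) = cyc_rel k `` {aleph (2 * k + 1) A}"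
proof -
  let ?n = "2 * k + 1"
  have A: "A \<subseteq> {..<?n}" using assms by (rule mid_vertex_subset)
  have fA: "aleph ?n A \<in> mid_vertices k"
    using assms aleph_level_lower aleph_level_upper by (auto simp: mid_vertices_def)
  have "aleph ?n (translate ?n t A) = translate ?n (t * (?n - 1)) (aleph ?n A)" for t
    using A by (intro aleph_translate) auto
  then have "aleph ?n (translate ?n t A) \<in> range (\<lambda>r. translate ?n r (aleph ?n A))" for t
    by (rule range_eqI)
  \<comment> \<open>For the other inclusion \<open>aleph_translate\<close> is used at
    \<open>aleph ?n A\<close>, and \<open>aleph\<close> is then applied to both sides.\<close>
  moreover have "translate ?n t (aleph ?n A) = aleph ?n (translate ?n (t * (?n - 1)) A)" for t
    using aleph_translate[of ?n "aleph ?n A" t] aleph_aleph[OF A] aleph_subset[of ?n A]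
      aleph_aleph[of "translate ?n t (aleph ?n A)" ?n] translate_subset[of ?n] by auto
  then have "translate ?n t (aleph ?n A) \<in> range (\<lambda>r. aleph ?n (translate ?n r A))" for t
    by (rule range_eqI)
  ultimately show ?thesis
    unfolding aleph_quot_def cyc_class[OF assms] cyc_class[OF fA] image_image
    by (intro equalityI image_subsetI)
qed

lemma aleph_quot_level:
  assumes "u \<in> level_quot k k"
  shows "aleph_quot k u \<in> level_quot k (k + 1)"
proof -
  obtain A where A: "A \<in> level (2 * k + 1) k" "u = cyc_rel k `` {A}" using assms by (rule level_quotE)
  then show ?thesis
    using aleph_quot_class[of A k] aleph_level_lower level_quotI by (simp add: mid_vertices_def)
qed

lemma aleph_quot_involution:
  assumes "A \<in> mid_vertices k"
  shows "aleph_quot k (aleph_quot k (cyc_rel k `` {A})) = cyc_rel k `` {A}"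
proof -
  have "aleph (2 * k + 1) A \<in> mid_vertices k"
    using assms aleph_level_lower aleph_level_upper by (auto simp: mid_vertices_def)
  then show ?thesis
    using aleph_quot_class assms aleph_aleph[OF mid_vertex_subset[OF assms]] by simp
qed

text \<open>Needed for \<open>inv_into\<close> in \<open>aleph_quot_inv\<close> to be a true left
  inverse; the same elementwise image serves as the inverse.\<close>

lemma inj_on_aleph_quot: "inj_on (aleph_quot k) (level_quot k k)"
proof (rule inj_on_inverseI[where g = "aleph_quot k"])
  fix u assume "u \<in> level_quot k k"
  then obtain A where "A \<in> level (2 * k + 1) k" "u = cyc_rel k `` {A}" by (rule level_quotE)
  then show "aleph_quot k (aleph_quot k u) = u"
    by (simp add: aleph_quot_involution mid_vertices_def)
qed

lemma aleph_quot_inv_class: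
  assumes "A \<in> level (2 * k + 1) (k + 1)"
  shows "aleph_quot_inv k (cyc_rel k `` {A}) = cyc_rel k `` {aleph (2 * k + 1) A}"
  unfolding aleph_quot_inv_def
proof (rule inv_into_f_eq[OF inj_on_aleph_quot])
  have A: "A \<in> mid_vertices k" using assms by (simp add: mid_vertices_def)
  show "cyc_rel k `` {aleph (2 * k + 1) A} \<in> level_quot k k"
    using assms aleph_level_upper level_quotI by blast
  show "aleph_quot k (cyc_rel k `` {aleph (2 * k + 1) A}) = cyc_rel k `` {A}"
    using aleph_quot_involution[OF A] aleph_quot_class[OF A] by simp
qed

text \<open>The partner is the orbit of the \<open>aleph\<close>-image of a representative. If it
  were horizontal, comparing ends level by level would make the given edge horizontal too.\<close>

lemma skew_quot_edge_partner:
  assumes "\<epsilon> \<in> quot_skew_edges k" "u \<in> level_quot k k" "w \<in> level_quot k (k + 1)"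
    and ends: "quot_ends k \<epsilon> = {u, w}"
  shows "aleph_quot_inv k w \<in> level_quot k k"
    and "\<exists>\<epsilon>' \<in> quot_skew_edges k. quot_ends k \<epsilon>' = {aleph_quot_inv k w, aleph_quot k u}"
proof -
  let ?f = "aleph (2 * k + 1)"
  have \<epsilon>: "\<epsilon> \<in> quot_edges k" "\<epsilon> \<notin> quot_horizontal_edges k"
    using assms(1) by (auto simp: quot_skew_edges_def)
  obtain A A' where A: "\<epsilon> = edge_rel k `` {{A, A'}}" "{A, A'} \<in> mid_edges k"
    "A \<in> level (2 * k + 1) k" "A' \<in> level (2 * k + 1) (k + 1)" "A \<subset> A'"
    using \<epsilon>(1) by (rule quot_edgeE)
  have "{u, w} = {cyc_rel k `` {A}, cyc_rel k `` {A'}}"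
    using ends quot_ends_class[OF A(2)] A(1) by simp
  then have uw: "u = cyc_rel k `` {A}" "w = cyc_rel k `` {A'}"
    using level_quot_doubleton_eq_iff[OF assms(2) level_quotI[OF A(3)] assms(3) level_quotI[OF A(4)]]
    by blast+
  have l: "?f A' \<in> level (2 * k + 1) k" "?f A \<in> level (2 * k + 1) (k + 1)"
    using A aleph_level_lower aleph_level_upper by blast+
  have inv: "aleph_quot_inv k w = cyc_rel k `` {?f A'}"
    using aleph_quot_inv_class A(4) uw by simp
  have im: "aleph_quot k u = cyc_rel k `` {?f A}"
    using aleph_quot_class[of A k] A(3) uw by (simp add: mid_vertices_def)
  show inl: "aleph_quot_inv k w \<in> level_quot k k" using inv l level_quotI by simp
  have w: "aleph_quot k (aleph_quot_inv k w) = w"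
    using aleph_quot_class[of "?f A'" k] inv uw l aleph_aleph A(4)
    by (simp add: mid_vertices_def level_def)
  have e: "{?f A', ?f A} \<in> mid_edges k"
    using doubleton_mid_edge_iff[OF l] aleph_strict_antimono[OF A(5)] A(4) by (simp add: level_def)
  let ?\<epsilon>' = "edge_rel k `` {{?f A', ?f A}}"
  have ends': "quot_ends k ?\<epsilon>' = {aleph_quot_inv k w, aleph_quot k u}"
    using quot_ends_class[OF e] inv im by simp
  have "?\<epsilon>' \<notin> quot_horizontal_edges k"
  proof
    assume "?\<epsilon>' \<in> quot_horizontal_edges k"
    then obtain v where v: "v \<in> level_quot k k"
      "{aleph_quot_inv k w, aleph_quot k u} = {v, aleph_quot k v}"
      using ends' by (auto simp: quot_horizontal_edges_def)
    have "aleph_quot_inv k w = v" "aleph_quot k u = aleph_quot k v"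
      using iffD1[OF level_quot_doubleton_eq_iff[OF inl v(1) aleph_quot_level[OF assms(2)]
          aleph_quot_level[OF v(1)]] v(2)] by simp_all
    \<comment> \<open>Both sides equal \<open>aleph_quot k v\<close>, because \<open>v\<close> is
      \<open>aleph_quot_inv k w\<close>.\<close>
    then have "w = aleph_quot k u" using w by simp
    then have "\<epsilon> \<in> quot_horizontal_edges k"
      using \<epsilon>(1) assms(2) ends by (auto simp: quot_horizontal_edges_def)
    with \<epsilon>(2) show False ..
  qed
  moreover have "?\<epsilon>' \<in> quot_edges k" using e by (simp add: quot_edges_def quotientI)
  ultimately show "\<exists>\<epsilon>' \<in> quot_skew_edges k.
      quot_ends k \<epsilon>' = {aleph_quot_inv k w, aleph_quot k u}"
    using ends' by (auto simp: quot_skew_edges_def)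
qed

subsection \<open>Centres of antisymmetry\<close>

text \<open>The position \<open>i\<close> is exempt because the reflection in \<open>i\<close> fixes
  it, and no position can differ from itself.\<close>

definition centres :: "nat \<Rightarrow> nat set \<Rightarrow> nat set" where
  "centres n A = {i. i < n \<and> (\<forall>x. x mod int n \<noteq> int i \<longrightarrow>
     (cmem n A x \<longleftrightarrow> \<not> cmem n A (2 * int i - x)))}"

lemma centresD:
  assumes "i \<in> centres n A" "x mod int n \<noteq> int i"
  shows "cmem n A x \<longleftrightarrow> \<not> cmem n A (2 * int i - x)"
  using assms by (auto simp: centres_def)

text \<open>Serves to certify that a position is not the exempt one when \<open>centresD\<close> is
  applied.\<close>

lemma mod_add_neq:
  assumes "a < n" "b < n" "a \<noteq> b"
  shows "(c + int a - int b) mod int n \<noteq> c mod int n"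
proof
  assume "(c + int a - int b) mod int n = c mod int n"
  then have "int n dvd int a - int b"
    by (simp add: mod_eq_dvd_iff algebra_simps)
  then have "int a mod int n = int b mod int n" by (simp add: mod_eq_dvd_iff)
  then show False using assms by simp
qed

text \<open>From \<open>x = f + i - j\<close>, the reflection in \<open>f\<close> and the reflection
  in \<open>i\<close> followed by that in \<open>j\<close> lead to the same point
  \<open>f + j - i\<close>, with one negation on the first route and two on the second. The three
  distinctness assumptions keep each reflection off its exempt position.\<close>

lemma centres_third:
  assumes i: "i \<in> centres n A" and j: "j \<in> centres n A" and f: "f \<in> centres n A"
    and "i \<noteq> j" "f \<noteq> i" "f \<noteq> j"
  shows False
proof -
  have lt: "i < n" "j < n" "f < n" using i j f by (auto simp: centres_def)
  define x where "x = int f + int i - int j"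
  have m: "int c mod int n = int c" if "c < n" for c using that by simp
  have "x mod int n \<noteq> int f" using mod_add_neq[of i n j "int f"] lt assms m by (simp add: x_def)
  from centresD[OF f this] have 1: "cmem n A x \<longleftrightarrow> \<not> cmem n A (int f + int j - int i)"
    by (simp add: x_def algebra_simps)
  have "x mod int n \<noteq> int i"
    using mod_add_neq[of f n j "int i"] lt assms m by (simp add: x_def add.commute)
  from centresD[OF i this] have 2: "cmem n A x \<longleftrightarrow> \<not> cmem n A (2 * int i - x)" .
  \<comment> \<open>The intermediate point differs from \<open>j\<close> by \<open>i - f\<close>, so
    it is not exempt for the centre \<open>j\<close>.\<close>
  have "2 * int i - x = int j + int i - int f" by (simp add: x_def)
  with mod_add_neq[of i n f "int j"] have "(2 * int i - x) mod int n \<noteq> int j"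
    using lt assms m by metis
  from centresD[OF j this] have 3: "cmem n A (2 * int i - x) \<longleftrightarrow> \<not> cmem n A (int f + int j - int i)"
    by (simp add: x_def algebra_simps)
  show False using 1 2 3 by blast
qed

lemma finite_centres: "finite (centres n A)"
  by (rule finite_subset[of _ "{..<n}"]) (auto simp: centres_def)

lemma card_centres_le_2: "card (centres n A) \<le> 2"
proof (rule ccontr)
  assume "\<not> ?thesis"
  then have "3 \<le> card (centres n A)" by simp
  then obtain T where T: "T \<subseteq> centres n A" "card T = 3"
    by (meson obtain_subset_with_card_n)
  then obtain i j f where "T = {i, j, f}" "i \<noteq> j" "f \<noteq> i" "f \<noteq> j"
    by (auto simp: card_3_iff)
  with T(1) show False using centres_third[of i n A j f] by auto
qed

text \<open>Shift and reversal together act as a reflection \<open>x \<mapsto> c - x\<close>; the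
  added element \<open>i\<close> forces \<open>c\<close> to be congruent to
  \<open>2 * i\<close>.\<close>

lemma insert_eq_aleph_translate_centre:
  assumes A: "A \<subseteq> {..<n}" and i: "i < n" "i \<notin> A"
    and eq: "insert i A = aleph n (translate n s A)"
  shows "i \<in> centres n A"
proof -
  have n: "0 < n" using i by simp
  define c where "c = - 1 - int s"
  have key: "cmem n A x \<or> x mod int n = int i \<longleftrightarrow> \<not> cmem n A (c - x)" for x
  proof -
    have "cmem n (insert i A) x \<longleftrightarrow> cmem n A x \<or> x mod int n = int i"
      using n by (auto simp: cmem_def)
    moreover have "cmem n (insert i A) x \<longleftrightarrow> \<not> cmem n A (- 1 - x - int s)"
      unfolding eq using n A by (simp add: cmem_aleph cmem_translate)
    moreover have "- 1 - x - int s = c - x" by (simp add: c_def)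
    ultimately show ?thesis by simp
  qed
  have nP: "\<not> cmem n A (int i)" using i by (simp add: cmem_int)
  have "\<not> cmem n A (c - int i)" using key[of "int i"] i by simp
  \<comment> \<open>As \<open>i\<close> is not in \<open>A\<close>, \<open>key\<close> puts
    \<open>c - i\<close> into \<open>insert i A\<close>; it is not in \<open>A\<close>, so it must
    be \<open>i\<close> itself.\<close>
  then have "(c - int i) mod int n = int i" using key[of "c - int i"] nP by simp
  then have "(c - int i) mod int n = int i mod int n" using i by simp
  then have "int n dvd c - 2 * int i"
    by (simp add: mod_eq_dvd_iff algebra_simps)
  then have "(c - x) mod int n = (2 * int i - x) mod int n" for x
    by (simp add: mod_eq_dvd_iff)
  then have "cmem n A (c - x) = cmem n A (2 * int i - x)" for x by (rule cmem_cong)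
  then show ?thesis using key i by (auto simp: centres_def)
qed

text \<open>Every such orbit has a representative whose lower end is the fixed set \<open>A\<close>.
  Its upper end adds one element, and horizontality makes this element a centre, so the orbits are
  covered by an image of the centres.\<close>

lemma horizontal_quot_edges_subset:
  assumes "A \<in> level (2 * k + 1) k"
  shows "{\<epsilon> \<in> quot_edges k. quot_ends k \<epsilon> = {cyc_rel k `` {A}, aleph_quot k (cyc_rel k `` {A})}}
    \<subseteq> (\<lambda>i. edge_rel k `` {{A, insert i A}}) ` centres (2 * k + 1) A"
proof
  let ?n = "2 * k + 1" and ?u = "cyc_rel k `` {A}"
  have Av: "A \<in> mid_vertices k" and As: "A \<subseteq> {..<?n}"
    using assms by (auto simp: mid_vertices_def level_def)
  fix \<epsilon> assume "\<epsilon> \<in> {\<epsilon> \<in> quot_edges k. quot_ends k \<epsilon> = {?u, aleph_quot k ?u}}"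
  then have \<epsilon>: "\<epsilon> \<in> quot_edges k" "quot_ends k \<epsilon> = {?u, aleph_quot k ?u}" by auto
  obtain C C' where C: "\<epsilon> = edge_rel k `` {{C, C'}}" "{C, C'} \<in> mid_edges k"
    "C \<in> level ?n k" "C' \<in> level ?n (k + 1)" "C \<subset> C'"
    using \<epsilon>(1) by (rule quot_edgeE)
  have Cv: "C \<in> mid_vertices k" "C' \<in> mid_vertices k"
    using C by (auto simp: mid_vertices_def)
  have "{cyc_rel k `` {C}, cyc_rel k `` {C'}} = {?u, aleph_quot k ?u}"
    using quot_ends_class[OF C(2)] C(1) \<epsilon>(2) by simp
  then have uC: "?u = cyc_rel k `` {C}" and wC: "aleph_quot k ?u = cyc_rel k `` {C'}"
    using level_quot_doubleton_eq_iff[of "cyc_rel k `` {C}" k ?u]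
      level_quotI C(3,4) assms aleph_quot_level by metis+
  \<comment> \<open>This shift moves the representative \<open>{C, C'}\<close> so that its lower end
    becomes \<open>A\<close>.\<close>
  obtain t where t: "A = translate ?n t C"
    using cyc_class_self[OF Av] unfolding uC cyc_class[OF Cv(1)] by blast
  define A' where "A' = translate ?n t C'"
  have A'l: "A' \<in> level ?n (k + 1)" using C(4) translate_level[of ?n] by (simp add: A'_def)
  have AA': "A \<subset> A'" unfolding t A'_def
    using C(4,5) by (intro translate_strict_mono) (auto simp: level_def)
  have \<epsilon>A: "\<epsilon> = edge_rel k `` {{A, A'}}"
    using edge_class_translate[OF C(2), of t] C(1) t by (simp add: A'_def)
  have "card (A' - A) = 1"
    using AA' A'l assms by (subst card_Diff_subset) (auto simp: level_def intro: finite_subset)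
  then obtain i where "A' - A = {i}" by (auto simp: card_1_singleton_iff)
  then have i: "A' = insert i A" "i \<notin> A" using AA' by auto
  then have "i < ?n" using A'l by (auto simp: level_def)
  have "A' \<in> aleph_quot k ?u"
    unfolding wC cyc_class[OF Cv(2)] A'_def by blast
  \<comment> \<open>The shift \<open>s\<close> comes from viewing \<open>aleph_quot k ?u\<close> as
    the \<open>aleph\<close>-image of the orbit of \<open>A\<close>.\<close>
  then obtain s where "insert i A = aleph ?n (translate ?n s A)"
    unfolding aleph_quot_def cyc_class[OF Av] i(1) by blast
  with As \<open>i < ?n\<close> i(2) have "i \<in> centres ?n A" by (rule insert_eq_aleph_translate_centre)
  then show "\<epsilon> \<in> (\<lambda>i. edge_rel k `` {{A, insert i A}}) ` centres ?n A"
    using \<epsilon>A i(1) by blast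
qed

text \<open>Finiteness is recorded as well because \<open>card\<close> is \<open>0\<close> on
  infinite sets, where the bound would say nothing.\<close>

lemma card_horizontal_quot_edges:
  assumes "u \<in> level_quot k k"
  shows "finite {\<epsilon> \<in> quot_edges k. quot_ends k \<epsilon> = {u, aleph_quot k u}}" (is "finite ?E")
    and "card {\<epsilon> \<in> quot_edges k. quot_ends k \<epsilon> = {u, aleph_quot k u}} \<le> 2"
proof -
  obtain A where A: "A \<in> level (2 * k + 1) k" "u = cyc_rel k `` {A}"
    using assms by (rule level_quotE)
  let ?g = "\<lambda>i. edge_rel k `` {{A, insert i A}}"
  have sub: "?E \<subseteq> ?g ` centres (2 * k + 1) A"
    using horizontal_quot_edges_subset[OF A(1)] A(2) by simp
  then show "finite ?E" by (rule finite_subset) (simp add: finite_centres)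
  have "card ?E \<le> card (?g ` centres (2 * k + 1) A)"
    using sub finite_centres by (intro card_mono) auto
  also have "\<dots> \<le> card (centres (2 * k + 1) A)" using finite_centres by (rule card_image_le)
  also have "\<dots> \<le> 2" by (rule card_centres_le_2)
  finally show "card ?E \<le> 2" .
qed

theorem theorem1:
  fixes k n :: nat
  assumes "k \<ge> 1" and "n = 2 * k + 1"
  shows "(\<forall>\<epsilon> \<in> quot_skew_edges k. \<forall>u \<in> level_quot k k. \<forall>w \<in> level_quot k (k + 1).
        quot_ends k \<epsilon> = {u, w} \<longrightarrow>
        aleph_quot_inv k w \<in> level_quot k k \<and> aleph_quot k u \<in> level_quot k (k + 1) \<and>
        (\<exists>\<epsilon>' \<in> quot_skew_edges k. quot_ends k \<epsilon>' = {aleph_quot_inv k w, aleph_quot k u}))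
    \<and> (\<forall>B \<in> level n k. \<forall>B' \<in> level n (k + 1). {B, B'} \<in> skew_edges k \<longrightarrow>
        {aleph_inv k B', aleph n B} \<in> skew_edges k \<and>
        {aleph_inv k B', aleph n B} \<noteq> {B, B'} \<and>
        (B, aleph n B) \<in> horizontal_pairs k \<and>
        (aleph_inv k B', B') \<in> horizontal_pairs k \<and>
        (B, aleph n B) \<noteq> (aleph_inv k B', B') \<and>
        {B, B'} \<union> {aleph_inv k B', aleph n B} = {B, aleph n B} \<union> {aleph_inv k B', B'})
    \<and> partition_on (skew_edges k)
        {{{B, B'}, {aleph_inv k B', aleph n B}} | B B'.
           B \<in> level n k \<and> B' \<in> level n (k + 1) \<and> {B, B'} \<in> skew_edges k}
    \<and> (\<forall>u \<in> level_quot k k.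
        finite {\<epsilon> \<in> quot_edges k. quot_ends k \<epsilon> = {u, aleph_quot k u}} \<and>
        card {\<epsilon> \<in> quot_edges k. quot_ends k \<epsilon> = {u, aleph_quot k u}} \<le> 2)"
  unfolding assms(2)
proof (intro conjI)
  show "\<forall>\<epsilon> \<in> quot_skew_edges k. \<forall>u \<in> level_quot k k. \<forall>w \<in> level_quot k (k + 1).
        quot_ends k \<epsilon> = {u, w} \<longrightarrow>
        aleph_quot_inv k w \<in> level_quot k k \<and> aleph_quot k u \<in> level_quot k (k + 1) \<and>
        (\<exists>\<epsilon>' \<in> quot_skew_edges k. quot_ends k \<epsilon>' = {aleph_quot_inv k w, aleph_quot k u})"
    by (intro ballI impI conjI skew_quot_edge_partner aleph_quot_level)
  show "partition_on (skew_edges k)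
        {{{B, B'}, {aleph_inv k B', aleph (2 * k + 1) B}} | B B'.
           B \<in> level (2 * k + 1) k \<and> B' \<in> level (2 * k + 1) (k + 1) \<and> {B, B'} \<in> skew_edges k}"
    by (rule partition_skew_edges)
  show "\<forall>u \<in> level_quot k k.
        finite {\<epsilon> \<in> quot_edges k. quot_ends k \<epsilon> = {u, aleph_quot k u}} \<and>
        card {\<epsilon> \<in> quot_edges k. quot_ends k \<epsilon> = {u, aleph_quot k u}} \<le> 2"
    by (intro ballI conjI card_horizontal_quot_edges)
  show "\<forall>B \<in> level (2 * k + 1) k. \<forall>B' \<in> level (2 * k + 1) (k + 1). {B, B'} \<in> skew_edges k \<longrightarrow>
      {aleph_inv k B', aleph (2 * k + 1) B} \<in> skew_edges k \<and>
      {aleph_inv k B', aleph (2 * k + 1) B} \<noteq> {B, B'} \<and>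
      (B, aleph (2 * k + 1) B) \<in> horizontal_pairs k \<and>
      (aleph_inv k B', B') \<in> horizontal_pairs k \<and>
      (B, aleph (2 * k + 1) B) \<noteq> (aleph_inv k B', B') \<and>
      {B, B'} \<union> {aleph_inv k B', aleph (2 * k + 1) B} =
        {B, aleph (2 * k + 1) B} \<union> {aleph_inv k B', B'}"
    by (intro ballI impI skew_edge_pair)
qed

end
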